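(* A binary relation $\succsim$ on $l_\infty$ satisfies Weak order, Monotonicity, Continuity, ICRP, Convexity and IDIS if and only if there exists a grounded and weak$^\star$-lower semicontinuous function $c:\mathcal D\to[0,\infty]$ such that $$I(x)=\min_{p\in\mathcal D}\{\langle x,p\rangle+c(p)\}$$ is a constant equivalent representing $\succsim$, where $\mathcal D=\mathcal B\cup\{(1-\delta)(1,\delta,\delta^2,\dots):\delta\in[0,1)\}$.
   Context: $l_\infty$: real bounded sequences $x=(x_0,x_1,\dots)$ with sup norm; $\theta\in\mathbb R$ also a constant sequence; $x\ge y$ coordinatewise. $ba(\mathbb N)$: norm dual of $l_\infty$ (bounded finitely additive signed measures on $2^{\mathbb N}$), pairing $\langle x,\mu\rangle$, weak$^\star$ topology. $\Delta$: finitely additive probability measures; sequences $(p_n)$ with $p_n\ge0,\sum p_n=1$ identified with countably additive measures; $\delta=0$ gives $(1,0,0,\dots)$. $\mathcal B$: Banach–Mazur limits, i.e. $\mu\in\Delta$ with $\langle x,\mu\rangle=\langle(x_1,x_2,\dots),\mu\rangle$ for all $x$. Grounded: infimum $0$. Constant equivalent: $I$ with $x\sim I(x)$, $x\succsim y\iff I(x)\ge I(y)$. Weak order: complete, transitive. Monotonicity: $x\ge y\Rightarrow x\succsim y$, $1\succ0$. Continuity: for $x\succsim y\succsim z$ the sets $\{\alpha\in[0,1]:\alpha x+(1-\alpha)z\succsim y\}$, $\{\alpha:y\succsim\alpha x+(1-\alpha)z\}$ are closed. ICRP: $x\succsim y\Rightarrow x+\theta\succsim y+\theta$. Convexity: $x\succsim\theta,y\succsim\theta\Rightarrow\lambda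 x+(1-\lambda)y\succsim\theta$ for $\lambda\in[0,1]$. IDIS: $x+d\succsim x\Rightarrow x+(0,d)\succsim x$, where $(0,d)=(0,d_0,d_1,\dots)$. *)

theory Defs
  imports "HOL-Analysis.Analysis"
begin

type_synonym seq = "nat \<Rightarrow> real"

definition linf :: "seq set" where
  "linf = {x. \<exists>B. \<forall>n. \<bar>x n\<bar> \<le> B}"

definition cseq :: "real \<Rightarrow> seq" where
  "cseq \<theta> = (\<lambda>_. \<theta>)"

definition shiftL :: "seq \<Rightarrow> seq" where
  "shiftL x = (\<lambda>n. x (Suc n))"

definition shiftR :: "seq \<Rightarrow> seq" where
  "shiftR d = (\<lambda>n. if n = 0 then 0 else d (n - 1))"

text \<open>An element of the dual of l_infinity is represented by the map x \<mapsto> <x,mu>;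
  it is normalised to be 0 outside l_infinity so that the representation is unique.\<close>

type_synonym functional = "seq \<Rightarrow> real"

text \<open>Delta: finitely additive probability measures, i.e. positive normalised
  linear functionals on l_infinity.\<close>
definition Delta :: "functional set" where
  "Delta = {p. (\<forall>x\<in>linf. \<forall>y\<in>linf. p (\<lambda>n. x n + y n) = p x + p y)
              \<and> (\<forall>x\<in>linf. \<forall>a. p (\<lambda>n. a * x n) = a * p x)
              \<and> (\<forall>x\<in>linf. (\<forall>n. x n \<ge> 0) \<longrightarrow> p x \<ge> 0)
              \<and> p (cseq 1) = 1
              \<and> (\<forall>x. x \<notin> linf \<longrightarrow> p x = 0)}"

definition BML :: "functional set" where
  "BML = {p \<in> Delta. \<forall>x\<in>linf. p x = p (shiftL x)}"

definition geom :: "real \<Rightarrow> functional" where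
  "geom \<delta> = (\<lambda>x. if x \<in> linf then (1 - \<delta>) * (\<Sum>n. \<delta> ^ n * x n) else 0)"

definition DD :: "functional set" where
  "DD = BML \<union> geom ` {0..<1}"

text \<open>Basic weak-star neighbourhoods of p: finitely many x in l_infinity, and eta > 0.\<close>
definition weak_star_lsc_on :: "functional set \<Rightarrow> (functional \<Rightarrow> ereal) \<Rightarrow> bool" where
  "weak_star_lsc_on S c \<longleftrightarrow>
     (\<forall>p\<in>S. \<forall>t. t < c p \<longrightarrow>
        (\<exists>F \<eta>. finite F \<and> F \<subseteq> linf \<and> \<eta> > 0 \<and>
           (\<forall>q\<in>S. (\<forall>x\<in>F. \<bar>q x - p x\<bar> < \<eta>) \<longrightarrow> t < c q)))"

definition weak_order :: "(seq \<Rightarrow> seq \<Rightarrow> bool) \<Rightarrow> bool" where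
  "weak_order R \<longleftrightarrow>
     (\<forall>x\<in>linf. \<forall>y\<in>linf. R x y \<or> R y x) \<and>
     (\<forall>x\<in>linf. \<forall>y\<in>linf. \<forall>z\<in>linf. R x y \<longrightarrow> R y z \<longrightarrow> R x z)"

definition monotonicity :: "(seq \<Rightarrow> seq \<Rightarrow> bool) \<Rightarrow> bool" where
  "monotonicity R \<longleftrightarrow>
     (\<forall>x\<in>linf. \<forall>y\<in>linf. (\<forall>n. x n \<ge> y n) \<longrightarrow> R x y) \<and>
     R (cseq 1) (cseq 0) \<and> \<not> R (cseq 0) (cseq 1)"

definition continuity :: "(seq \<Rightarrow> seq \<Rightarrow> bool) \<Rightarrow> bool" where
  "continuity R \<longleftrightarrow>
     (\<forall>x\<in>linf. \<forall>y\<in>linf. \<forall>z\<in>linf. R x y \<longrightarrow> R y z \<longrightarrow>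
        closed {\<alpha>::real. \<alpha> \<in> {0..1} \<and> R (\<lambda>n. \<alpha> * x n + (1 - \<alpha>) * z n) y} \<and>
        closed {\<alpha>::real. \<alpha> \<in> {0..1} \<and> R y (\<lambda>n. \<alpha> * x n + (1 - \<alpha>) * z n)})"

definition ICRP :: "(seq \<Rightarrow> seq \<Rightarrow> bool) \<Rightarrow> bool" where
  "ICRP R \<longleftrightarrow>
     (\<forall>x\<in>linf. \<forall>y\<in>linf. \<forall>\<theta>::real. R x y \<longrightarrow> R (\<lambda>n. x n + \<theta>) (\<lambda>n. y n + \<theta>))"

definition convexity :: "(seq \<Rightarrow> seq \<Rightarrow> bool) \<Rightarrow> bool" where
  "convexity R \<longleftrightarrow>
     (\<forall>x\<in>linf. \<forall>y\<in>linf. \<forall>\<theta>::real. R x (cseq \<theta>) \<longrightarrow> R y (cseq \<theta>) \<longrightarrow>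
        (\<forall>l\<in>{0..1::real}. R (\<lambda>n. l * x n + (1 - l) * y n) (cseq \<theta>)))"

definition IDIS :: "(seq \<Rightarrow> seq \<Rightarrow> bool) \<Rightarrow> bool" where
  "IDIS R \<longleftrightarrow>
     (\<forall>x\<in>linf. \<forall>d\<in>linf. R (\<lambda>n. x n + d n) x \<longrightarrow> R (\<lambda>n. x n + shiftR d n) x)"

definition constant_equivalent :: "(seq \<Rightarrow> seq \<Rightarrow> bool) \<Rightarrow> (seq \<Rightarrow> real) \<Rightarrow> bool" where
  "constant_equivalent R I \<longleftrightarrow>
     (\<forall>x\<in>linf. R x (cseq (I x)) \<and> R (cseq (I x)) x) \<and>
     (\<forall>x\<in>linf. \<forall>y\<in>linf. R x y \<longleftrightarrow> I x \<ge> I y)"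

end

theory Submission
  imports Defs
begin

text \<open>The axioms say that the constant equivalent I is monotone, translation invariant, concave
  and satisfies I (x + d) \<ge> I x \<Longrightarrow> I (x + S d) \<ge> I x for the right shift S. Given such
  an I, put c p = sup (I x - p x); everything then follows once I has at each x a supergradient
  in D, i.e. one with p (S d) = \<delta> * p d for some \<delta> in [0,1]. The directional derivative G
  of I at x is superlinear and G d \<ge> 0 implies G (S d) \<ge> 0. By Hahn-Banach an eigenfunctional
  p \<ge> G with p (S d) = \<delta> * p d exists as soon as G (S d - \<delta> d) \<le> 0 for all d. To find
  \<delta>, take any linear p \<ge> G; invariance gives p (S^n y) \<ge> G y * a n with a n = p (S^n 1), and
  \<delta> can be taken to be the exponential growth rate of a.
  Conversely, p (x + S d) = p x + \<delta> * p d is at least the smaller of p x and p (x + d), so each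
  p in D, and hence the minimum over D, satisfies IDIS.\<close>

section \<open>Superlinear functionals\<close>

text \<open>These are the negatives of sublinear functionals; lower bounds are the natural form for
  supergradients of a concave functional.\<close>

definition superlinear :: "('v::real_vector \<Rightarrow> real) \<Rightarrow> bool" where
  "superlinear G \<longleftrightarrow> (\<forall>x y. G x + G y \<le> G (x + y)) \<and> (\<forall>r\<ge>0. \<forall>x. G (r *\<^sub>R x) = r * G x)"

lemma superlinear_add: "superlinear G \<Longrightarrow> G x + G y \<le> G (x + y)"
  by (simp add: superlinear_def)

lemma superlinear_scale: "superlinear G \<Longrightarrow> 0 \<le> r \<Longrightarrow> G (r *\<^sub>R x) = r * G x"
  by (simp add: superlinear_def)

lemma superlinear_zero: "superlinear G \<Longrightarrow> G 0 = 0"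
  using superlinear_scale[of G 0 0] by simp

lemma superlinear_minus: "superlinear G \<Longrightarrow> G x \<le> - G (- x)"
  using superlinear_add[of G x "- x"] by (simp add: superlinear_zero)

text \<open>A pair (k, s) in K encodes the constraint p k \<le> s: any linear p \<ge> H satisfies it
  (take x = - k).\<close>

lemma superlinear_extend:
  fixes G :: "'v::real_vector \<Rightarrow> real" and K :: "('v \<times> real) set"
  assumes G: "superlinear G"
    and zero: "0 \<in> K"
    and add: "\<And>a b. a \<in> K \<Longrightarrow> b \<in> K \<Longrightarrow> a + b \<in> K"
    and scale: "\<And>r a. r > 0 \<Longrightarrow> a \<in> K \<Longrightarrow> r *\<^sub>R a \<in> K"
    and le: "\<And>k s. (k, s) \<in> K \<Longrightarrow> G k \<le> s"
  obtains H where "superlinear H" "\<And>x k s. (k, s) \<in> K \<Longrightarrow> G (x + k) - s \<le> H x"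
proof -
  \<comment> \<open>This is the least superlinear functional above \<open>G\<close> obeying the
    constraints: a superlinear \<open>H' \<ge> G\<close> with \<open>H' (- k) \<ge> - s\<close> has
    \<open>H' x \<ge> H' (x + k) + H' (- k) \<ge> G (x + k) - s\<close>.\<close>
  define H where "H x = (SUP a\<in>K. G (x + fst a) - snd a)" for x
  \<comment> \<open>The bound must be uniform over \<open>K\<close>: superadditivity gives
    \<open>G (x + k) + G (- x) \<le> G k \<le> s\<close>.\<close>
  have bdd: "bdd_above ((\<lambda>a. G (x + fst a) - snd a) ` K)" for x
  proof (rule bdd_aboveI2)
    fix a assume "a \<in> K"
    then have "G (fst a) \<le> snd a" using le[of "fst a" "snd a"] by simp
    then show "G (x + fst a) - snd a \<le> - G (- x)"
      using superlinear_add[OF G, of "x + fst a" "- x"] by simp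
  qed
  have upper: "G (x + fst a) - snd a \<le> H x" if "a \<in> K" for x a
    unfolding H_def using that by (rule cSUP_upper[OF _ bdd])
  have least: "H x \<le> B" if "\<And>a. a \<in> K \<Longrightarrow> G (x + fst a) - snd a \<le> B" for x B
    unfolding H_def using zero that by (intro cSUP_least) auto
  have Hadd: "H x + H y \<le> H (x + y)" for x y
  proof -
    have "H x \<le> H (x + y) - H y"
    proof (rule least)
      fix a assume a: "a \<in> K"
      have "H y \<le> H (x + y) - (G (x + fst a) - snd a)"
      proof (rule least)
        fix b assume b: "b \<in> K"
        show "G (y + fst b) - snd b \<le> H (x + y) - (G (x + fst a) - snd a)"
          using superlinear_add[OF G, of "x + fst a" "y + fst b"] upper[OF add[OF a b], of "x + y"]
          by (simp add: algebra_simps)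
      qed
      then show "G (x + fst a) - snd a \<le> H (x + y) - H y" by simp
    qed
    then show ?thesis by simp
  qed
  have Hsc: "r * H x \<le> H (r *\<^sub>R x)" if "r > 0" for r x
  proof -
    have "H x \<le> H (r *\<^sub>R x) / r"
    proof (rule least)
      fix a assume a: "a \<in> K"
      show "G (x + fst a) - snd a \<le> H (r *\<^sub>R x) / r"
        using upper[OF scale[OF that a], of "r *\<^sub>R x"] superlinear_scale[OF G, of r "x + fst a"] that
        by (simp add: field_simps scaleR_add_right)
    qed
    then show ?thesis using that by (simp add: field_simps)
  qed
  have H0: "H 0 = 0"
  proof (rule antisym)
    show "H 0 \<le> 0" using le by (intro least) auto
    show "0 \<le> H 0" using upper[OF zero, of 0] superlinear_zero[OF G] by simp
  qed
  have "H (r *\<^sub>R x) = r * H x" if "r \<ge> 0" for r x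
  proof (cases "r = 0")
    case False
    then have r: "r > 0" using that by simp
    have "inverse r * H (r *\<^sub>R x) \<le> H x" using Hsc[of "inverse r" "r *\<^sub>R x"] r by simp
    then have "H (r *\<^sub>R x) \<le> r * H x" using r by (simp add: field_simps)
    then show ?thesis using Hsc[OF r, of x] by simp
  qed (simp add: H0)
  then have "superlinear H" using Hadd by (simp add: superlinear_def)
  then show thesis using that upper by fastforce
qed

section \<open>Hahn-Banach theorem for superlinear functionals\<close>

text \<open>Zorn's lemma yields a maximal superlinear functional above \<open>G\<close>. It is
  linear, since otherwise \<open>superlinear_extend\<close> would enlarge it strictly.\<close>

lemma hahn_banach_superlinear:
  fixes G :: "'v::real_vector \<Rightarrow> real"
  assumes G: "superlinear G"
  obtains p where "linear p" "\<And>x. G x \<le> p x"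
proof -
  define A where "A = {H. superlinear H \<and> G \<le> H}"
  have "\<exists>m\<in>A. \<forall>a\<in>A. m \<le> a \<longrightarrow> a = m"
  proof (rule predicate_Zorn)
    show "partial_order_on A (relation_of (\<le>) A)"
      by (rule partial_order_on_relation_ofI) auto
    fix C assume C: "C \<in> Chains (relation_of (\<le>) A)"
    then have CA: "C \<subseteq> A" and tot: "\<And>a b. a \<in> C \<Longrightarrow> b \<in> C \<Longrightarrow> a \<le> b \<or> b \<le> a"
      by (auto simp: Chains_def relation_of_def)
    show "\<exists>u\<in>A. \<forall>a\<in>C. a \<le> u"
    proof (cases "C = {}")
      case True then show ?thesis using G by (auto simp: A_def)
    next
      case False
      define U where "U x = (SUP H\<in>C. H x)" for x
      have sl: "superlinear H" if "H \<in> C" for H using CA that by (auto simp: A_def)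
      \<comment> \<open>Superlinearity caps the whole chain:
        \<open>H x \<le> - H (- x) \<le> - G (- x)\<close>.\<close>
      have bdd: "bdd_above ((\<lambda>H. H x) ` C)" for x
      proof (rule bdd_aboveI2)
        fix H assume H: "H \<in> C"
        then have "G (- x) \<le> H (- x)" using CA by (auto simp: A_def le_fun_def)
        then show "H x \<le> - G (- x)" using superlinear_minus[OF sl[OF H], of x] by simp
      qed
      have upper: "H x \<le> U x" if "H \<in> C" for H x
        unfolding U_def using that by (rule cSUP_upper[OF _ bdd])
      have least: "U x \<le> B" if "\<And>H. H \<in> C \<Longrightarrow> H x \<le> B" for x B
        unfolding U_def using False that by (intro cSUP_least) auto
      have "U x + U y \<le> U (x + y)" for x y
      proof -
        have "U x \<le> U (x + y) - U y"
        proof (rule least)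
          fix H assume H: "H \<in> C"
          have "U y \<le> U (x + y) - H x"
          proof (rule least)
            fix H' assume H': "H' \<in> C"
            \<comment> \<open>Superadditivity of the supremum needs one member above both
              \<open>H\<close> and \<open>H'\<close>; in a chain the larger of the two
              serves.\<close>
            obtain M where M: "M \<in> C" "H \<le> M" "H' \<le> M" using tot[OF H H'] H H' by auto
            have "H x + H' y \<le> M x + M y" using M by (simp add: add_mono le_funD)
            also have "\<dots> \<le> U (x + y)" using superlinear_add[OF sl[OF M(1)]] upper[OF M(1)] by (rule order_trans)
            finally show "H' y \<le> U (x + y) - H x" by simp
          qed
          then show "H x \<le> U (x + y) - U y" by simp
        qed
        then show ?thesis by simp
      qed
      moreover have "U (r *\<^sub>R x) = r * U x" if "r \<ge> 0" for r x
      proof -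
        have le: "U (r *\<^sub>R x) \<le> r * U x" if "r \<ge> 0" for r x
          using that by (intro least) (simp add: superlinear_scale[OF sl] mult_left_mono upper)
        show ?thesis
        proof (cases "r = 0")
          case True
          obtain H where "H \<in> C" using False by blast
          then show ?thesis using True le[of 0 x] upper[of H 0] superlinear_zero[OF sl] by fastforce
        next
          case False
          then have r: "r > 0" using that by simp
          have "U x \<le> inverse r * U (r *\<^sub>R x)" using le[of "inverse r" "r *\<^sub>R x"] r by simp
          then show ?thesis using le[OF that, of x] r by (simp add: field_simps)
        qed
      qed
      ultimately have "superlinear U" by (simp add: superlinear_def)
      moreover have "G \<le> U"
      proof (rule le_funI)
        fix x
        obtain H where H: "H \<in> C" using False by blast
        then have "G x \<le> H x" using CA by (auto simp: A_def le_fun_def)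
        then show "G x \<le> U x" using upper[OF H, of x] by simp
      qed
      ultimately show ?thesis using upper by (intro bexI[of _ U]) (auto simp: A_def le_fun_def)
    qed
  qed
  then obtain p where p: "superlinear p" "G \<le> p" and max: "\<And>H. superlinear H \<Longrightarrow> p \<le> H \<Longrightarrow> H = p"
    unfolding A_def using order_trans by blast
  \<comment> \<open>By maximality, imposing the constraint that y has value at most p y changes nothing.\<close>
  have sub: "p (x + y) \<le> p x + p y" for x y
  proof -
    define K where "K = (\<lambda>t. (t *\<^sub>R y, t * p y)) ` {0..}"
    obtain H where H: "superlinear H" "\<And>x k s. (k, s) \<in> K \<Longrightarrow> p (x + k) - s \<le> H x"
    proof (rule superlinear_extend[OF p(1), of K])
      show "0 \<in> K" by (force simp: K_def zero_prod_def)
      show "a + b \<in> K" if "a \<in> K" "b \<in> K" for a b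
        using that by (auto simp: K_def scaleR_add_left[symmetric] distrib_right[symmetric])
      show "r *\<^sub>R a \<in> K" if "r > 0" "a \<in> K" for r a
        using that by (auto simp: K_def mult.assoc[symmetric] intro!: image_eqI)
      show "p k \<le> s" if "(k, s) \<in> K" for k s
        using that superlinear_scale[OF p(1)] by (auto simp: K_def)
    qed blast
    have "(0, 0) \<in> K" "(y, p y) \<in> K"
      by (force simp: K_def) (force simp: K_def intro!: image_eqI[of _ _ 1])
    then have "H = p" using H(2)[of 0 0] by (intro max H(1) le_funI) simp
    then show ?thesis using H(2)[OF \<open>(y, p y) \<in> K\<close>, of x] by simp
  qed
  then have add: "p (x + y) = p x + p y" for x y
    using superlinear_add[OF p(1)] by (simp add: antisym)
  have neg: "p (- x) = - p x" for x using add[of x "- x"] superlinear_zero[OF p(1)] by simp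
  have "p (r *\<^sub>R x) = r * p x" for r x
  proof (cases "r \<ge> 0")
    case False
    then show ?thesis using superlinear_scale[OF p(1), of "- r" x] neg[of "r *\<^sub>R x"] by simp
  qed (rule superlinear_scale[OF p(1)])
  then have "linear p" using add by (intro linearI) auto
  then show thesis using that p(2) by (auto simp: le_fun_def)
qed

section \<open>Growth rates and eigenfunctionals\<close>

text \<open>The right \<open>\<delta>\<close> is the limsup of the n-th roots of \<open>a n\<close>,
  written as the infimum of all \<open>s > 0\<close> with \<open>a n = O(s ^ n)\<close>. A sequence
  of order \<open>a\<close> cannot keep a surplus proportional to \<open>a\<close> over this rate;
  the lemma rules such sequences out.\<close>

lemma geometric_growth_rate:
  fixes a :: "nat \<Rightarrow> real"
  assumes a0: "a 0 = 1" and dec: "\<And>n. a (Suc n) \<le> a n" and nonneg: "\<And>n. 0 \<le> a n"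
  obtains \<delta> where "0 \<le> \<delta>" "\<delta> \<le> 1"
    "\<And>u \<epsilon> B. \<lbrakk>\<epsilon> > 0; \<And>n. \<bar>u n\<bar> \<le> B * a n; \<And>n. \<delta> * u n + \<epsilon> * a n \<le> u (Suc n)\<rbrakk> \<Longrightarrow> False"
proof -
  define X where "X = {s. s > 0 \<and> (\<exists>C. \<forall>n. a n \<le> C * s ^ n)}"
  define \<delta> where "\<delta> = Inf X"
  have bdd: "bdd_below X" by (rule bdd_belowI[of _ 0]) (auto simp: X_def)
  have "a n \<le> 1" for n by (induction n) (use a0 dec order_trans in auto)
  then have X1: "1 \<in> X" unfolding X_def by (intro CollectI conjI exI[of _ 1]) simp_all
  have \<delta>0: "0 \<le> \<delta>"
    unfolding \<delta>_def
  proof (rule cInf_greatest)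
    show "X \<noteq> {}" using X1 by blast
  qed (simp add: X_def)
  have \<delta>1: "\<delta> \<le> 1" unfolding \<delta>_def using X1 bdd by (rule cInf_lower)
  have False if \<epsilon>: "\<epsilon> > 0" and bnd: "\<And>n. \<bar>u n\<bar> \<le> B * a n"
    and rec: "\<And>n. \<delta> * u n + \<epsilon> * a n \<le> u (Suc n)" for u \<epsilon> and B :: real
  proof -
    \<comment> \<open>\<open>B\<close> may be 0, and a positive bound is needed as a
      divisor.\<close>
    define B' where "B' = max B 1"
    have B': "B' > 0" by (simp add: B'_def)
    have bnd': "\<bar>u n\<bar> \<le> B' * a n" for n
      using bnd[of n] mult_right_mono[of B B' "a n"] nonneg[of n] by (simp add: B'_def)
    \<comment> \<open>Since \<open>\<eta> * \<bar>u n\<bar> \<le> \<epsilon> * a n\<close>, the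
      recurrence gains a rate: the factor is at least \<open>\<delta> + \<eta>\<close> where
      \<open>u\<close> is positive, and \<open>- u\<close> shrinks by at least
      \<open>\<delta> - \<eta>\<close> where \<open>u\<close> is negative.\<close>
    define \<eta> where "\<eta> = \<epsilon> / B'"
    have \<eta>: "\<eta> > 0" using \<epsilon> B' by (simp add: \<eta>_def)
    have bnd2: "\<eta> * \<bar>u n\<bar> \<le> \<epsilon> * a n" for n
      using mult_left_mono[OF bnd'[of n], of \<eta>] \<eta> B' by (simp add: \<eta>_def)
    show False
    \<comment> \<open>If u is positive somewhere, a grows faster than \<delta>; otherwise a decays faster than \<delta>.\<close>
    proof (cases "\<exists>m. u m > 0")
      case True
      then obtain m where m: "u m > 0" by blast
      have step: "(\<delta> + \<eta>) * u n \<le> u (Suc n)" for n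
      proof -
        have "\<eta> * u n \<le> \<eta> * \<bar>u n\<bar>" using \<eta> by (intro mult_left_mono) auto
        then show ?thesis using rec[of n] bnd2[of n] by (simp add: distrib_right)
      qed
      have grow: "(\<delta> + \<eta>) ^ k * u m \<le> u (m + k)" for k
      proof (induction k)
        case (Suc k)
        have "(\<delta> + \<eta>) ^ Suc k * u m \<le> (\<delta> + \<eta>) * u (m + k)"
          using mult_left_mono[OF Suc, of "\<delta> + \<eta>"] \<delta>0 \<eta> by (simp add: mult.assoc)
        then show ?case using step[of "m + k"] by simp
      qed simp
      \<comment> \<open>As \<open>\<delta>\<close> is an infimum, some admissible \<open>s\<close>
        lies below \<open>\<delta> + \<eta>\<close>; the bound \<open>C * s ^ n\<close> on
        \<open>a\<close> is then beaten by the growth of \<open>u\<close>.\<close>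
      obtain s where s: "s \<in> X" "s < \<delta> + \<eta>"
        using cInf_lessD[of X "\<delta> + \<eta>"] X1 \<eta> unfolding \<delta>_def by auto
      then obtain C where C: "s > 0" "\<And>n. a n \<le> C * s ^ n" by (auto simp: X_def)
      have "((\<delta> + \<eta>) / s) ^ k \<le> B' * C * s ^ m / u m" for k
      proof -
        have "(\<delta> + \<eta>) ^ k * u m \<le> B' * a (m + k)" using grow[of k] bnd'[of "m + k"] by simp
        also have "\<dots> \<le> B' * (C * s ^ (m + k))" using C(2) B' by simp
        finally show ?thesis using C(1) m by (simp add: field_simps power_add)
      qed
      moreover obtain k where "B' * C * s ^ m / u m < ((\<delta> + \<eta>) / s) ^ k"
        using real_arch_pow[of "(\<delta> + \<eta>) / s" "B' * C * s ^ m / u m"] s C(1) by auto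
      ultimately show False by (meson not_le)
    next
      case False
      then have np: "u n \<le> 0" for n by (meson not_le)
      \<comment> \<open>With \<open>\<delta> = 0\<close> the recurrence at index 0 would give
        \<open>u 1 \<ge> \<epsilon> > 0\<close>.\<close>
      have "\<delta> \<noteq> 0" using rec[of 0] np[of 1] \<epsilon> a0 by auto
      then have dpos: "\<delta> > 0" using \<delta>0 by simp
      \<comment> \<open>The value \<open>\<delta> - \<eta>\<close> is the decay rate wanted; the
        maximum with \<open>\<delta> / 2\<close> keeps \<open>s\<close> positive, as membership in
        \<open>X\<close> requires, and still below \<open>\<delta>\<close>.\<close>
      define s where "s = max (\<delta> / 2) (\<delta> - \<eta>)"
      have s: "s > 0" "s < \<delta>" "\<delta> - \<eta> \<le> s" using dpos \<eta> by (auto simp: s_def)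
      have step: "- u (Suc n) \<le> s * (- u n)" for n
      proof -
        have "(\<delta> - \<eta>) * (- u n) \<le> s * (- u n)" using s(3) np[of n] by (intro mult_right_mono) auto
        then show ?thesis using rec[of n] bnd2[of n] np[of n] by (simp add: algebra_simps)
      qed
      have decay: "- u n \<le> s ^ n * (- u 0)" for n
      proof (induction n)
        case (Suc n)
        have "- u (Suc n) \<le> s * (- u n)" by (rule step)
        also have "\<dots> \<le> s * (s ^ n * (- u 0))" using Suc s(1) by (intro mult_left_mono) auto
        finally show ?case by (simp add: mult.assoc)
      qed simp
      \<comment> \<open>Because \<open>u (Suc n) \<le> 0\<close>, the recurrence bounds
        \<open>\<epsilon> * a n\<close> by \<open>\<delta> * (- u n)\<close>, so \<open>a\<close>
        inherits the decay of \<open>- u\<close>.\<close>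
      have "a n \<le> (\<delta> * (- u 0) / \<epsilon>) * s ^ n" for n
      proof -
        have "\<epsilon> * a n \<le> \<delta> * (- u n)" using rec[of n] np[of "Suc n"] by simp
        also have "\<dots> \<le> \<delta> * (s ^ n * (- u 0))" using decay[of n] dpos by (intro mult_left_mono) auto
        finally show ?thesis using \<epsilon> by (simp add: field_simps)
      qed
      then have "s \<in> X" unfolding X_def using s(1) by blast
      then have "\<delta> \<le> s" unfolding \<delta>_def using bdd by (rule cInf_lower)
      then show False using s(2) by simp
    qed
  qed
  then show thesis using that \<delta>0 \<delta>1 by blast
qed

text \<open>Hahn-Banach is used twice. The first functional \<open>p\<close> serves only to find
  \<open>\<delta>\<close>; the eigenfunctional \<open>q\<close> comes from a second application,
  after the constraints for this \<open>\<delta>\<close> have been imposed on \<open>G\<close>. In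
  the application \<open>e\<close> is the constant sequence 1 and \<open>S\<close> the right
  shift.\<close>

lemma superlinear_eigenfunctional:
  fixes G :: "'v::real_vector \<Rightarrow> real" and S :: "'v \<Rightarrow> 'v" and e :: 'v
  assumes G: "superlinear G" and S: "linear S"
    and trans: "\<And>x r. G (x + r *\<^sub>R e) = G x + r"
    and inv: "\<And>x. 0 \<le> G x \<Longrightarrow> 0 \<le> G (S x)"
    and Se: "0 \<le> G (e - S e)"
  obtains \<delta> q where "0 \<le> \<delta>" "\<delta> \<le> 1" "linear q" "\<And>x. G x \<le> q x" "\<And>x. q (S x) = \<delta> * q x"
proof -
  obtain p where p: "linear p" "\<And>x. G x \<le> p x" using hahn_banach_superlinear[OF G] by blast
  have invn: "0 \<le> p ((S ^^ n) x)" if "0 \<le> G x" for n x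
  proof -
    have "0 \<le> G ((S ^^ n) x)" by (induction n) (use that inv in auto)
    then show ?thesis using p(2) order_trans by blast
  qed
  have lin: "linear (\<lambda>x. p ((S ^^ n) x))" for n
  proof -
    have "linear (S ^^ n)"
      by (induction n) (simp_all only: funpow.simps linear_id linear_compose[OF _ S])
    then show ?thesis using linear_compose[OF _ p(1)] by (simp add: o_def)
  qed
  define a where "a n = p ((S ^^ n) e)" for n
  have Ge: "G e = 1" "G (- e) = -1" using trans[of 0 1] trans[of 0 "-1"] superlinear_zero[OF G] by auto
  have low: "G x * a n \<le> p ((S ^^ n) x)" for x n
  proof -
    \<comment> \<open>Moving \<open>x\<close> by \<open>- G x\<close> along \<open>e\<close> brings
      the value of \<open>G\<close> to 0, where the invariance under \<open>S\<close>
      applies.\<close>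
    have "0 \<le> p ((S ^^ n) (x + (- G x) *\<^sub>R e))" by (rule invn) (subst trans, simp)
    then show ?thesis
      using linear_add[OF lin[of n]] linear_scale[OF lin[of n]] linear_diff[OF lin[of n]] by (simp add: a_def)
  qed
  have "a 0 = 1"
    using p(2)[of e] p(2)[of "- e"] Ge linear_neg[OF p(1)] by (simp add: a_def)
  moreover have "a (Suc n) \<le> a n" for n
    using invn[OF Se, of n] linear_diff[OF lin[of n]] by (simp add: a_def funpow_Suc_right del: funpow.simps)
  moreover have a: "0 \<le> a n" for n using invn[of e n] Ge by (simp add: a_def)
  ultimately obtain \<delta> where \<delta>: "0 \<le> \<delta>" "\<delta> \<le> 1"
    and contr: "\<And>u \<epsilon> B. \<lbrakk>\<epsilon> > 0; \<And>n. \<bar>u n\<bar> \<le> B * a n; \<And>n. \<delta> * u n + \<epsilon> * a n \<le> u (Suc n)\<rbrakk> \<Longrightarrow> False"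
    using geometric_growth_rate by blast
  have neg: "G (S d - \<delta> *\<^sub>R d) \<le> 0" for d
  proof (rule ccontr)
    assume "\<not> ?thesis"
    then have \<epsilon>: "G (S d - \<delta> *\<^sub>R d) > 0" by simp
    \<comment> \<open>The sequence to be ruled out is \<open>p ((S ^^ n) d)\<close>. The bound
      \<open>low\<close> at \<open>d\<close> and \<open>- d\<close> makes it of order
      \<open>a\<close>, and \<open>low\<close> at \<open>S d - \<delta> *\<^sub>R d\<close> gives
      the recurrence with surplus \<open>G (S d - \<delta> *\<^sub>R d)\<close>.\<close>
    define B where "B = max (- G d) (- G (- d))"
    show False
    proof (rule contr[OF \<epsilon>, of "\<lambda>n. p ((S ^^ n) d)" B])
      fix n
      have B: "- B \<le> G d" "- B \<le> G (- d)" by (simp_all add: B_def)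
      have "- B * a n \<le> p ((S ^^ n) d)"
        using mult_right_mono[OF B(1) a[of n]] low[of d n] by simp
      moreover have "- B * a n \<le> p ((S ^^ n) (- d))"
        using mult_right_mono[OF B(2) a[of n]] low[of "- d" n] by simp
      ultimately show "\<bar>p ((S ^^ n) d)\<bar> \<le> B * a n"
        using linear_neg[OF lin[of n]] by (simp add: abs_le_iff)
      show "\<delta> * p ((S ^^ n) d) + G (S d - \<delta> *\<^sub>R d) * a n \<le> p ((S ^^ Suc n) d)"
        using low[of "S d - \<delta> *\<^sub>R d" n] linear_diff[OF lin[of n]] linear_scale[OF lin[of n]]
        by (simp add: funpow_Suc_right del: funpow.simps)
    qed
  qed
  \<comment> \<open>The constraints force \<open>q \<le> 0\<close> on the range of
    \<open>S - \<delta>\<close>. That range is a subspace, so \<open>q\<close> vanishes on it, which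
    is the eigenvalue equation.\<close>
  define K where "K = range (\<lambda>d. (S d - \<delta> *\<^sub>R d, 0 :: real))"
  obtain H where H: "superlinear H" "\<And>x k s. (k, s) \<in> K \<Longrightarrow> G (x + k) - s \<le> H x"
  proof (rule superlinear_extend[OF G, of K])
    show "0 \<in> K" unfolding K_def by (rule range_eqI[of _ _ 0]) (simp add: linear_0[OF S] zero_prod_def)
    show "a + b \<in> K" if ab: "a \<in> K" "b \<in> K" for a b
    proof -
      obtain x y where "a = (S x - \<delta> *\<^sub>R x, 0)" "b = (S y - \<delta> *\<^sub>R y, 0)"
        using ab unfolding K_def by blast
      then show ?thesis unfolding K_def
        by (intro range_eqI[of _ _ "x + y"]) (simp add: linear_add[OF S] algebra_simps)
    qed
    show "r *\<^sub>R a \<in> K" if ra: "r > 0" "a \<in> K" for r a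
    proof -
      obtain x where "a = (S x - \<delta> *\<^sub>R x, 0)" using ra unfolding K_def by blast
      then show ?thesis unfolding K_def
        by (intro range_eqI[of _ _ "r *\<^sub>R x"]) (simp add: linear_scale[OF S] algebra_simps)
    qed
    show "G k \<le> s" if "(k, s) \<in> K" for k s using that neg by (auto simp: K_def)
  qed blast
  obtain q where q: "linear q" "\<And>x. H x \<le> q x" using hahn_banach_superlinear[OF H(1)] by blast
  have GH: "G x \<le> H x" for x
    using H(2)[of 0 0 x] rangeI[of "\<lambda>d. (S d - \<delta> *\<^sub>R d, 0 :: real)" 0] by (simp add: K_def linear_0[OF S])
  have nonpos: "q (S d) - \<delta> * q d \<le> 0" for d
  proof -
    have "0 \<le> H (- (S d - \<delta> *\<^sub>R d))"
      using H(2)[of "S d - \<delta> *\<^sub>R d" 0 "- (S d - \<delta> *\<^sub>R d)"] superlinear_zero[OF G] by (simp add: K_def)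
    also have "\<dots> \<le> q (- (S d - \<delta> *\<^sub>R d))" by (rule q(2))
    also have "\<dots> = - (q (S d) - \<delta> * q d)"
      by (simp only: linear_neg[OF q(1)] linear_diff[OF q(1)] linear_scale[OF q(1)] real_scaleR_def)
    finally show ?thesis by simp
  qed
  have "q (S d) = \<delta> * q d" for d
    using nonpos[of d] nonpos[of "- d"] linear_neg[OF q(1)] linear_neg[OF S] by simp
  moreover have "G x \<le> q x" for x using GH q(2) order_trans by blast
  ultimately show thesis using that \<delta> q(1) by blast
qed

section \<open>Directional derivatives of concave functionals\<close>

text \<open>Concavity makes the difference quotient nonincreasing in \<open>t\<close>, so the
  one-sided derivative is its supremum over \<open>t > 0\<close>. The two bounds say that
  \<open>G d\<close> is this supremum, which spares all limits.\<close>

lemma concave_directional_derivative: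
  fixes J :: "'v::real_vector \<Rightarrow> real"
  assumes J: "concave_on UNIV J"
  obtains G where "superlinear G" "\<And>d t. t > 0 \<Longrightarrow> J (u + t *\<^sub>R d) - J u \<le> t * G d"
    "\<And>d B. (\<And>t. t > 0 \<Longrightarrow> J (u + t *\<^sub>R d) - J u \<le> t * B) \<Longrightarrow> G d \<le> B"
proof -
  define G where "G d = (SUP t\<in>{0<..}. (J (u + t *\<^sub>R d) - J u) / t)" for d
  \<comment> \<open>The weights \<open>t / (s + t)\<close> and \<open>s / (s + t)\<close> give both
    directions the common step \<open>s * t / (s + t)\<close>, so two difference quotients combine
    into one for \<open>d + d'\<close>.\<close>
  have conc: "t * J (u + s *\<^sub>R d) + s * J (u + t *\<^sub>R d') \<le> (s + t) * J (u + (s * t / (s + t)) *\<^sub>R (d + d'))"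
    if "s > 0" "t > 0" for s t d d'
  proof -
    have "(t / (s + t)) * J (u + s *\<^sub>R d) + (s / (s + t)) * J (u + t *\<^sub>R d')
        \<le> J ((t / (s + t)) *\<^sub>R (u + s *\<^sub>R d) + (s / (s + t)) *\<^sub>R (u + t *\<^sub>R d'))"
      using that by (intro J[unfolded concave_on_iff, THEN conjunct2, rule_format])
        (simp_all add: add_divide_distrib[symmetric] add.commute)
    also have "(t / (s + t)) *\<^sub>R (u + s *\<^sub>R d) + (s / (s + t)) *\<^sub>R (u + t *\<^sub>R d')
        = (t / (s + t) + s / (s + t)) *\<^sub>R u + (s * t / (s + t)) *\<^sub>R (d + d')"
      by (simp add: algebra_simps)
    also have "t / (s + t) + s / (s + t) = 1"
      using that by (simp add: add_divide_distrib[symmetric] add.commute)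
    finally have "(t * J (u + s *\<^sub>R d) + s * J (u + t *\<^sub>R d')) / (s + t)
        \<le> J (u + (s * t / (s + t)) *\<^sub>R (d + d'))"
      by (simp add: add_divide_distrib)
    then show ?thesis using that by (simp only: pos_divide_le_eq add_pos_pos mult.commute)
  qed
  \<comment> \<open>In \<open>conc\<close> with second direction \<open>- d\<close> and step 1 the
    directions cancel and the right side is \<open>(t + 1) * J u\<close>; this bounds the quotients
    independently of \<open>t\<close>.\<close>
  have bdd: "bdd_above ((\<lambda>t. (J (u + t *\<^sub>R d) - J u) / t) ` {0<..})" for d
  proof (rule bdd_aboveI2)
    fix t :: real assume "t \<in> {0<..}"
    then show "(J (u + t *\<^sub>R d) - J u) / t \<le> J u - J (u + (- d))"
      using conc[of t 1 d "- d"] by (simp add: field_simps)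
  qed
  have upper: "(J (u + t *\<^sub>R d) - J u) / t \<le> G d" if "t > 0" for d t
    unfolding G_def using bdd that by (intro cSUP_upper) auto
  have least: "G d \<le> B" if "\<And>t. t > 0 \<Longrightarrow> (J (u + t *\<^sub>R d) - J u) / t \<le> B" for d B
    unfolding G_def using that by (intro cSUP_least) auto
  have "G d + G d' \<le> G (d + d')" for d d'
  proof -
    have "G d \<le> G (d + d') - G d'"
    proof (rule least)
      fix s :: real assume s: "s > 0"
      have "G d' \<le> G (d + d') - (J (u + s *\<^sub>R d) - J u) / s"
      proof (rule least)
        fix t :: real assume t: "t > 0"
        define m where "m = J (u + (s * t / (s + t)) *\<^sub>R (d + d'))"
        have "(J (u + s *\<^sub>R d) - J u) / s + (J (u + t *\<^sub>R d') - J u) / t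
            = (t * J (u + s *\<^sub>R d) + s * J (u + t *\<^sub>R d') - (s + t) * J u) / (s * t)"
          using s t by (simp add: field_simps)
        also have "\<dots> \<le> ((s + t) * m - (s + t) * J u) / (s * t)"
          using conc[OF s t, of d d'] s t by (intro divide_right_mono) (simp_all add: m_def)
        also have "\<dots> = (m - J u) / (s * t / (s + t))"
          using s t by (simp add: field_simps)
        finally have "(J (u + s *\<^sub>R d) - J u) / s + (J (u + t *\<^sub>R d') - J u) / t
            \<le> (m - J u) / (s * t / (s + t))" .
        also have "\<dots> \<le> G (d + d')" unfolding m_def using s t by (intro upper) simp
        finally show "(J (u + t *\<^sub>R d') - J u) / t \<le> G (d + d') - (J (u + s *\<^sub>R d) - J u) / s" by simp
      qed
      then show "(J (u + s *\<^sub>R d) - J u) / s \<le> G (d + d') - G d'" by simp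
    qed
    then show ?thesis by simp
  qed
  moreover have "G (r *\<^sub>R d) = r * G d" if "r \<ge> 0" for r d
  proof -
    have le: "G (r *\<^sub>R d) \<le> r * G d" if r: "r > 0" for r d
    proof (rule least)
      fix t :: real assume "t > 0"
      then show "(J (u + t *\<^sub>R (r *\<^sub>R d)) - J u) / t \<le> r * G d"
        using upper[of "t * r" d] r by (simp add: field_simps)
    qed
    show ?thesis
    proof (cases "r = 0")
      case True
      have "G 0 \<le> 0" by (rule least) simp
      moreover have "0 \<le> G 0" using upper[of 1 0] by simp
      ultimately show ?thesis using True by simp
    next
      case False
      then have r: "r > 0" using that by simp
      have "G d \<le> inverse r * G (r *\<^sub>R d)" using le[of "inverse r" "r *\<^sub>R d"] r by simp
      then show ?thesis using le[OF r, of d] r by (simp add: field_simps)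
    qed
  qed
  ultimately have "superlinear G" by (simp add: superlinear_def)
  then show thesis
  proof (rule that)
    show "J (u + t *\<^sub>R d) - J u \<le> t * G d" if "t > 0" for t d
      using upper[OF that, of d] that by (simp add: field_simps)
    show "G d \<le> B" if "\<And>t. t > 0 \<Longrightarrow> J (u + t *\<^sub>R d) - J u \<le> t * B" for d B
      using that by (intro least) (simp add: field_simps)
  qed
qed

section \<open>Characterisation of D\<close>

lemma linf_add: "x \<in> linf \<Longrightarrow> y \<in> linf \<Longrightarrow> (\<lambda>n. x n + y n) \<in> linf"
  unfolding linf_def mem_Collect_eq by (metis abs_triangle_ineq add_mono order_trans)

lemma linf_scale: "x \<in> linf \<Longrightarrow> (\<lambda>n. a * x n) \<in> linf"
  unfolding linf_def mem_Collect_eq by (metis abs_ge_zero abs_mult mult_left_mono)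

lemma linf_const: "(\<lambda>n. r) \<in> linf"
  unfolding linf_def by auto

lemma linf_cseq: "cseq r \<in> linf"
  unfolding cseq_def by (rule linf_const)

lemma linf_compose: "x \<in> linf \<Longrightarrow> (\<lambda>n. x (f n)) \<in> linf"
  unfolding linf_def by auto

lemma linf_shiftL: "x \<in> linf \<Longrightarrow> shiftL x \<in> linf"
  unfolding shiftL_def by (rule linf_compose)

lemma linf_shiftR: "x \<in> linf \<Longrightarrow> shiftR x \<in> linf"
proof -
  assume "x \<in> linf"
  then obtain B where "\<And>n. \<bar>x n\<bar> \<le> B" by (auto simp: linf_def)
  then have "\<bar>shiftR x n\<bar> \<le> max B 0" for n by (simp add: shiftR_def le_max_iff_disj)
  then show ?thesis unfolding linf_def by blast
qed

lemma linf_combination: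
  "x \<in> linf \<Longrightarrow> y \<in> linf \<Longrightarrow> (\<lambda>n. a * x n + b * y n) \<in> linf"
  by (intro linf_add linf_scale)

lemma Delta_add: "p \<in> Delta \<Longrightarrow> x \<in> linf \<Longrightarrow> y \<in> linf \<Longrightarrow> p (\<lambda>n. x n + y n) = p x + p y"
  and Delta_scale: "p \<in> Delta \<Longrightarrow> x \<in> linf \<Longrightarrow> p (\<lambda>n. a * x n) = a * p x"
  and Delta_nonneg: "p \<in> Delta \<Longrightarrow> x \<in> linf \<Longrightarrow> (\<And>n. 0 \<le> x n) \<Longrightarrow> 0 \<le> p x"
  by (auto simp: Delta_def)

lemma Delta_const: "p \<in> Delta \<Longrightarrow> p (\<lambda>n. r) = r"
  using Delta_scale[of p "cseq 1" r] linf_cseq[of 1] by (simp add: Delta_def cseq_def)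

lemma Delta_add_const: "p \<in> Delta \<Longrightarrow> x \<in> linf \<Longrightarrow> p (\<lambda>n. x n + r) = p x + r"
  using Delta_add[of p x "\<lambda>n. r"] linf_const by (simp add: Delta_const[of p])

lemma Delta_combination:
  "p \<in> Delta \<Longrightarrow> x \<in> linf \<Longrightarrow> y \<in> linf \<Longrightarrow> p (\<lambda>n. a * x n + b * y n) = a * p x + b * p y"
  by (simp add: Delta_add[of p] Delta_scale[of p] linf_scale)

lemma Delta_mono:
  assumes "p \<in> Delta" "x \<in> linf" "y \<in> linf" "\<And>n. y n \<le> x n"
  shows "p y \<le> p x"
  using Delta_nonneg[OF assms(1) linf_combination[OF assms(2,3), of 1 "-1"]] assms
    Delta_combination[OF assms(1-3), of 1 "-1"] by simp

lemma Delta_abs_le: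
  assumes "p \<in> Delta" "x \<in> linf" "\<And>n. \<bar>x n\<bar> \<le> B"
  shows "\<bar>p x\<bar> \<le> B"
proof -
  have "- B \<le> x n" "x n \<le> B" for n using assms(3)[of n] by linarith+
  then have "p x \<le> p (\<lambda>_. B)" "p (\<lambda>_. - B) \<le> p x"
    using Delta_mono[OF assms(1) linf_const assms(2)] Delta_mono[OF assms(1,2) linf_const] by blast+
  then show ?thesis by (simp add: Delta_const[OF assms(1)])
qed

lemma summable_geom:
  assumes "0 \<le> \<delta>" "\<delta> < 1" "x \<in> linf"
  shows "summable (\<lambda>n. \<delta> ^ n * x n)"
proof -
  obtain B where "\<And>n. \<bar>x n\<bar> \<le> B" using assms by (auto simp: linf_def)
  then have "norm (\<delta> ^ n * x n) \<le> B * \<delta> ^ n" for n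
    using assms mult_left_mono[of "\<bar>x n\<bar>" B "\<delta> ^ n"] by (simp add: abs_mult mult.commute)
  then show ?thesis
    using assms by (intro summable_comparison_test'[OF summable_mult[OF summable_geometric, of \<delta> B], of 0]) auto
qed

lemma geom_Delta:
  assumes \<delta>: "0 \<le> \<delta>" "\<delta> < 1"
  shows "geom \<delta> \<in> Delta"
  unfolding Delta_def mem_Collect_eq
proof (intro conjI ballI allI impI)
  fix x y assume xy: "x \<in> linf" "y \<in> linf"
  then show "geom \<delta> (\<lambda>n. x n + y n) = geom \<delta> x + geom \<delta> y"
    using suminf_add[OF summable_geom[OF \<delta> xy(1)] summable_geom[OF \<delta> xy(2)]]
    by (simp add: geom_def linf_add flip: distrib_left)
next
  fix x a assume x: "x \<in> linf"
  then show "geom \<delta> (\<lambda>n. a * x n) = a * geom \<delta> x"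
    using suminf_mult[OF summable_geom[OF \<delta> x], of a] by (simp add: geom_def linf_scale algebra_simps)
next
  fix x assume "x \<in> linf" "\<forall>n. 0 \<le> x n"
  then show "0 \<le> geom \<delta> x" using \<delta> by (simp add: geom_def suminf_nonneg summable_geom)
next
  show "geom \<delta> (cseq 1) = 1"
    using \<delta> linf_cseq[of 1] suminf_geometric[of \<delta>] by (simp add: geom_def cseq_def)
qed (simp add: geom_def)

lemma geom_shiftR:
  assumes \<delta>: "0 \<le> \<delta>" "\<delta> < 1" and x: "x \<in> linf"
  shows "geom \<delta> (shiftR x) = \<delta> * geom \<delta> x"
proof -
  have "(\<Sum>n. \<delta> ^ n * shiftR x n) = (\<Sum>n. \<delta> * (\<delta> ^ n * x n))"
    using suminf_split_head[OF summable_geom[OF \<delta> linf_shiftR[OF x]]] by (simp add: shiftR_def mult.assoc)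
  also have "\<dots> = \<delta> * (\<Sum>n. \<delta> ^ n * x n)"
    using suminf_mult[OF summable_geom[OF \<delta> x]] by simp
  finally show ?thesis by (simp add: geom_def x linf_shiftR)
qed

text \<open>Split \<open>x\<close> into its head and the right shift of its tail. The weight of the
  head is fixed by normalisation: the constant sequence 1 gives
  \<open>1 = p e + \<delta>\<close>.\<close>

lemma shiftR_eigen_recurrence:
  assumes p: "p \<in> Delta" and eig: "\<And>x. x \<in> linf \<Longrightarrow> p (shiftR x) = \<delta> * p x" and x: "x \<in> linf"
  shows "p x = (1 - \<delta>) * x 0 + \<delta> * p (shiftL x)"
proof -
  define e where "e = (\<lambda>n::nat. if n = 0 then 1 else 0 :: real)"
  have e: "e \<in> linf" unfolding e_def linf_def by (auto intro: exI[of _ 1])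
  have split: "p y = y 0 * p e + \<delta> * p (shiftL y)" if y: "y \<in> linf" for y
  proof -
    have "y = (\<lambda>n. y 0 * e n + shiftR (shiftL y) n)" by (auto simp: e_def shiftR_def shiftL_def)
    then have "p y = p (\<lambda>n. y 0 * e n + shiftR (shiftL y) n)" by simp
    also have "\<dots> = y 0 * p e + \<delta> * p (shiftL y)"
      by (simp add: Delta_add[OF p] Delta_scale[OF p] linf_scale linf_shiftR linf_shiftL e y eig)
    finally show ?thesis .
  qed
  have "p e = 1 - \<delta>" using split[OF linf_const, of 1] by (simp add: shiftL_def Delta_const[OF p])
  then show ?thesis using split[OF x] by (simp add: mult.commute)
qed

text \<open>This is the form in which supergradients are produced and IDIS is checked. For \<delta>
  = 1 the recurrence is shift invariance; for \<delta> < 1, iterating it n times leaves a remainder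
  of at most \<open>B * \<delta> ^ n\<close>, so only the geometric weights survive.\<close>

lemma DD_iff:
  "p \<in> DD \<longleftrightarrow> p \<in> Delta \<and> (\<exists>\<delta>\<in>{0..1}. \<forall>x\<in>linf. p (shiftR x) = \<delta> * p x)"
proof
  assume "p \<in> DD"
  then consider "p \<in> BML" | \<delta> where "0 \<le> \<delta>" "\<delta> < 1" "p = geom \<delta>" by (auto simp: DD_def)
  then show "p \<in> Delta \<and> (\<exists>\<delta>\<in>{0..1}. \<forall>x\<in>linf. p (shiftR x) = \<delta> * p x)"
  proof cases
    case 1
    \<comment> \<open>Invariance applied to \<open>shiftR x\<close> therefore gives eigenvalue
      1.\<close>
    have "shiftL (shiftR x) = x" for x by (simp add: shiftL_def shiftR_def)
    then show ?thesis using 1 linf_shiftR by (auto simp: BML_def intro!: bexI[of _ 1])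
  next
    case 2
    then show ?thesis using geom_Delta geom_shiftR by (auto intro!: bexI[of _ \<delta>])
  qed
next
  assume "p \<in> Delta \<and> (\<exists>\<delta>\<in>{0..1}. \<forall>x\<in>linf. p (shiftR x) = \<delta> * p x)"
  then obtain \<delta> where p: "p \<in> Delta" and \<delta>: "0 \<le> \<delta>" "\<delta> \<le> 1"
    and eig: "\<And>x. x \<in> linf \<Longrightarrow> p (shiftR x) = \<delta> * p x" by auto
  have rec: "p x = (1 - \<delta>) * x 0 + \<delta> * p (shiftL x)" if "x \<in> linf" for x
    using p eig that by (rule shiftR_eigen_recurrence)
  show "p \<in> DD"
  proof (cases "\<delta> = 1")
    case True
    then show ?thesis using rec p by (auto simp: DD_def BML_def)
  next
    case False
    then have \<delta>1: "\<delta> < 1" using \<delta> by simp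
    have "p x = geom \<delta> x" if x: "x \<in> linf" for x
    proof -
      obtain B where B: "\<And>n. \<bar>x n\<bar> \<le> B" using x by (auto simp: linf_def)
      have iter: "p x = (1 - \<delta>) * (\<Sum>k<n. \<delta> ^ k * x k) + \<delta> ^ n * p (\<lambda>k. x (k + n))" for n
      proof (induction n)
        case (Suc n)
        show ?case using Suc rec[OF linf_compose[OF x], of "\<lambda>k. k + n"]
          by (simp add: shiftL_def algebra_simps)
      qed simp
      have "(\<lambda>n. B * \<delta> ^ n) \<longlonglongrightarrow> 0"
        using \<delta> \<delta>1 tendsto_mult_right_zero[OF LIMSEQ_realpow_zero] by blast
      then have "(\<lambda>n. \<delta> ^ n * p (\<lambda>k. x (k + n))) \<longlonglongrightarrow> 0"
      proof (rule Lim_null_comparison[rotated], intro always_eventually allI)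
        fix n
        have "\<bar>p (\<lambda>k. x (k + n))\<bar> \<le> B" by (rule Delta_abs_le[OF p linf_compose[OF x] B])
        then show "norm (\<delta> ^ n * p (\<lambda>k. x (k + n))) \<le> B * \<delta> ^ n"
          using \<delta> mult_left_mono[of "\<bar>p (\<lambda>k. x (k + n))\<bar>" B "\<delta> ^ n"] by (simp add: abs_mult mult.commute)
      qed
      moreover have "(\<lambda>n. (1 - \<delta>) * (\<Sum>k<n. \<delta> ^ k * x k)) \<longlonglongrightarrow> (1 - \<delta>) * (\<Sum>k. \<delta> ^ k * x k)"
        by (intro tendsto_mult_left summable_LIMSEQ summable_geom \<delta>(1) \<delta>1 x)
      ultimately have "(\<lambda>n. (1 - \<delta>) * (\<Sum>k<n. \<delta> ^ k * x k) + \<delta> ^ n * p (\<lambda>k. x (k + n)))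
          \<longlonglongrightarrow> (1 - \<delta>) * (\<Sum>k. \<delta> ^ k * x k) + 0"
        by (intro tendsto_add)
      then have "(\<lambda>n. p x) \<longlonglongrightarrow> (1 - \<delta>) * (\<Sum>k. \<delta> ^ k * x k) + 0"
        unfolding iter[symmetric] .
      then show ?thesis using x by (simp add: geom_def LIMSEQ_const_iff)
    qed
    \<comment> \<open>Both functionals are 0 off \<open>linf\<close> by convention, so agreement on
      \<open>linf\<close> is equality.\<close>
    then have "p = geom \<delta>" using p by (auto simp: geom_def Delta_def)
    then show ?thesis using \<delta> \<delta>1 by (auto simp: DD_def)
  qed
qed

lemma DD_zero: "p \<in> DD \<Longrightarrow> p (cseq 0) = 0"
  using Delta_const[of p 0] by (simp add: DD_iff cseq_def)

text \<open>Thus groundedness of the cost \<open>c\<close> is the normalisation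
  \<open>I (cseq 0) = 0\<close>.\<close>

lemma INF_at_zero: "(INF p\<in>DD. ereal (p (cseq 0)) + c p) = (INF p\<in>DD. c p)"
proof (rule INF_cong)
  fix p assume "p \<in> DD"
  then show "ereal (p (cseq 0)) + c p = c p" using DD_zero[of p] by (simp flip: zero_ereal_def)
qed simp

section \<open>Constant equivalents\<close>

text \<open>A niveloid is a monotone translation-invariant functional; concavity and the functional
  form of IDIS are added. Both directions of the theorem pass through this notion.\<close>

definition shift_niveloid :: "(seq \<Rightarrow> real) \<Rightarrow> bool" where
  "shift_niveloid I \<longleftrightarrow>
     I (cseq 0) = 0 \<and>
     (\<forall>x\<in>linf. \<forall>y\<in>linf. (\<forall>n. y n \<le> x n) \<longrightarrow> I y \<le> I x) \<and>
     (\<forall>x\<in>linf. \<forall>r. I (\<lambda>n. x n + r) = I x + r) \<and>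
     (\<forall>x\<in>linf. \<forall>y\<in>linf. \<forall>l\<in>{0..1}. l * I x + (1 - l) * I y \<le> I (\<lambda>n. l * x n + (1 - l) * y n)) \<and>
     (\<forall>x\<in>linf. \<forall>d\<in>linf. I x \<le> I (\<lambda>n. x n + d n) \<longrightarrow> I x \<le> I (\<lambda>n. x n + shiftR d n))"

lemma niveloid_mono:
    "shift_niveloid I \<Longrightarrow> x \<in> linf \<Longrightarrow> y \<in> linf \<Longrightarrow> (\<And>n. y n \<le> x n) \<Longrightarrow> I y \<le> I x"
  and niveloid_translate: "shift_niveloid I \<Longrightarrow> x \<in> linf \<Longrightarrow> I (\<lambda>n. x n + r) = I x + r"
  and niveloid_concave:
    "shift_niveloid I \<Longrightarrow> x \<in> linf \<Longrightarrow> y \<in> linf \<Longrightarrow> 0 \<le> l \<Longrightarrow> l \<le> 1 \<Longrightarrow>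
      l * I x + (1 - l) * I y \<le> I (\<lambda>n. l * x n + (1 - l) * y n)"
  and niveloid_shiftR:
    "shift_niveloid I \<Longrightarrow> x \<in> linf \<Longrightarrow> d \<in> linf \<Longrightarrow> I x \<le> I (\<lambda>n. x n + d n) \<Longrightarrow>
      I x \<le> I (\<lambda>n. x n + shiftR d n)"
  unfolding shift_niveloid_def by auto

lemma niveloid_cseq: "shift_niveloid I \<Longrightarrow> I (cseq r) = r"
  using niveloid_translate[OF _ linf_cseq, of I 0 r] by (simp add: shift_niveloid_def cseq_def)

lemma niveloid_lipschitz:
  assumes I: "shift_niveloid I" and "x \<in> linf" "y \<in> linf" "\<And>n. \<bar>x n - y n\<bar> \<le> B"
  shows "\<bar>I x - I y\<bar> \<le> B"
proof -
  have *: "I x \<le> I y + B" if "x \<in> linf" "y \<in> linf" "\<And>n. \<bar>x n - y n\<bar> \<le> B" for x y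
  proof -
    have "x n \<le> y n + B" for n using that(3)[of n] by simp
    then have "I x \<le> I (\<lambda>n. y n + B)" using that by (intro niveloid_mono[OF I] linf_add linf_const)
    then show ?thesis using niveloid_translate[OF I that(2)] by simp
  qed
  show ?thesis
    using *[of x y] *[of y x] assms by (simp add: abs_le_iff abs_minus_commute)
qed

section \<open>Supergradients in \<open>DD\<close>\<close>

text \<open>Every function on the discrete space \<open>nat\<close> is continuous. The type of
  bounded continuous functions thus gives \<open>linf\<close> the \<open>real_vector\<close>
  structure that the results on superlinear functionals require.\<close>

lemma bcontfun_nat: "(bcontfun :: seq set) = linf"
  by (auto simp: bcontfun_def linf_def bounded_iff)

lemma linf_apply_bcontfun: "apply_bcontfun (v :: nat \<Rightarrow>\<^sub>C real) \<in> linf"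
  using apply_bcontfun[of v] by (simp add: bcontfun_nat)

lemma apply_Bcontfun: "x \<in> linf \<Longrightarrow> apply_bcontfun (Bcontfun x) = x"
  by (simp add: Bcontfun_inverse bcontfun_nat)

text \<open>The directional derivative \<open>G\<close> of \<open>I\<close> at \<open>x\<close>
  inherits positivity, translation invariance and the IDIS property. An eigenfunctional above
  \<open>G\<close> is then a supergradient, and by \<open>DD_iff\<close> it lies in
  \<open>DD\<close>.\<close>

lemma niveloid_supergradient:
  assumes I: "shift_niveloid I" and x: "x \<in> linf"
  obtains p where "p \<in> DD" "\<And>y. y \<in> linf \<Longrightarrow> I y - p y \<le> I x - p x"
proof -
  define J where "J v = I (apply_bcontfun v)" for v :: "nat \<Rightarrow>\<^sub>C real"
  define S where "S v = Bcontfun (shiftR (apply_bcontfun v))" for v :: "nat \<Rightarrow>\<^sub>C real"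
  define e :: "nat \<Rightarrow>\<^sub>C real" where "e = const_bcontfun 1"
  define u where "u = Bcontfun x"
  have S_apply: "apply_bcontfun (S v) = shiftR (apply_bcontfun v)" for v
    unfolding S_def by (intro apply_Bcontfun linf_shiftR linf_apply_bcontfun)
  have e_apply: "apply_bcontfun e n = 1" for n by (simp add: e_def const_bcontfun.rep_eq)
  have S: "linear S"
    by (intro linearI bcontfun_eqI) (simp_all add: S_apply shiftR_def)
  have "concave_on UNIV J"
    unfolding concave_on_iff
  proof (intro conjI ballI allI impI)
    fix v w :: "nat \<Rightarrow>\<^sub>C real" and a b :: real assume ab: "0 \<le> a" "0 \<le> b" "a + b = 1"
    then have b: "b = 1 - a" by simp
    have "apply_bcontfun (a *\<^sub>R v + b *\<^sub>R w) = (\<lambda>n. a * v n + b * w n)"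
      by auto
    then show "a * J v + b * J w \<le> J (a *\<^sub>R v + b *\<^sub>R w)"
      using niveloid_concave[OF I linf_apply_bcontfun linf_apply_bcontfun, of a v w] ab
      unfolding J_def b by simp
  qed simp
  then obtain G where G: "superlinear G"
    and G_ge: "\<And>d t. t > 0 \<Longrightarrow> J (u + t *\<^sub>R d) - J u \<le> t * G d"
    and G_le: "\<And>d B. (\<And>t. t > 0 \<Longrightarrow> J (u + t *\<^sub>R d) - J u \<le> t * B) \<Longrightarrow> G d \<le> B"
    by (rule concave_directional_derivative[of J u]) blast
  have J_e: "J (v + r *\<^sub>R e) = J v + r" for v :: "nat \<Rightarrow>\<^sub>C real" and r
  proof -
    have "apply_bcontfun (v + r *\<^sub>R e) = (\<lambda>n. v n + r)" by (auto simp: e_apply)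
    then show ?thesis by (simp add: J_def niveloid_translate[OF I linf_apply_bcontfun])
  qed
  have J_mono: "J v \<le> J w" if "\<And>n. v n \<le> w n" for v w :: "nat \<Rightarrow>\<^sub>C real"
    unfolding J_def by (rule niveloid_mono[OF I linf_apply_bcontfun linf_apply_bcontfun that])
  have G_nonneg: "0 \<le> G d" if "t > 0" "J u \<le> J (u + t *\<^sub>R d)" for t d
  proof -
    have "0 \<le> t * G d" using G_ge[OF that(1), of d] that(2) by linarith
    then show ?thesis using that(1) by (simp add: zero_le_mult_iff)
  qed
  have G_e: "G (d + r *\<^sub>R e) = G d + r" for d r
  proof -
    have le: "G (d + r *\<^sub>R e) \<le> G d + r" for d r
    proof (rule G_le)
      fix t :: real assume t: "t > 0"
      have "u + t *\<^sub>R (d + r *\<^sub>R e) = (u + t *\<^sub>R d) + (t * r) *\<^sub>R e" by (simp add: algebra_simps)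
      then have "J (u + t *\<^sub>R (d + r *\<^sub>R e)) = J (u + t *\<^sub>R d) + t * r" by (simp only: J_e)
      then show "J (u + t *\<^sub>R (d + r *\<^sub>R e)) - J u \<le> t * (G d + r)"
        using G_ge[OF t, of d] by (simp add: distrib_left)
    qed
    show ?thesis using le[of d r] le[of "d + r *\<^sub>R e" "- r"] by simp
  qed
  \<comment> \<open>From \<open>G d \<ge> 0\<close> alone no single step need weakly improve
    \<open>u\<close>, as \<open>G d\<close> is only a supremum of quotients. Adding
    \<open>\<epsilon> *\<^sub>R e\<close> makes it positive, so some step strictly improves
    \<open>u\<close> and IDIS applies there; \<epsilon> is arbitrary.\<close>
  have G_S: "0 \<le> G (S d)" if d: "0 \<le> G d" for d
  proof (rule field_le_epsilon)
    fix \<epsilon> :: real assume \<epsilon>: "\<epsilon> > 0"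
    have "\<exists>t>0. J u < J (u + t *\<^sub>R (d + \<epsilon> *\<^sub>R e))"
    proof (rule ccontr)
      assume "\<not> ?thesis"
      then have "J (u + t *\<^sub>R (d + \<epsilon> *\<^sub>R e)) - J u \<le> t * 0" if "t > 0" for t
        using that by (simp add: not_less) (meson not_le)
      then have "G (d + \<epsilon> *\<^sub>R e) \<le> 0" by (rule G_le)
      then show False using G_e d \<epsilon> by simp
    qed
    then obtain t where t: "t > 0" "J u < J (u + t *\<^sub>R (d + \<epsilon> *\<^sub>R e))" by blast
    have plus: "apply_bcontfun (v + w) = (\<lambda>n. v n + w n)" for v w :: "nat \<Rightarrow>\<^sub>C real" by auto
    have "J u \<le> J (u + S (t *\<^sub>R (d + \<epsilon> *\<^sub>R e)))"
      using t(2) unfolding J_def plus[of u] S_apply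
      by (intro niveloid_shiftR[OF I] linf_apply_bcontfun) simp
    \<comment> \<open>The shift puts 0 in front, so \<open>S e \<le> e\<close> and replacing
      \<open>S e\<close> by \<open>e\<close> only raises the value.\<close>
    also have "\<dots> \<le> J (u + t *\<^sub>R (S d + \<epsilon> *\<^sub>R e))"
      using t(1) \<epsilon> by (intro J_mono) (simp add: S_apply shiftR_def e_apply)
    finally have "0 \<le> G (S d + \<epsilon> *\<^sub>R e)" using G_nonneg t(1) by blast
    then show "0 \<le> G (S d) + \<epsilon>" by (simp add: G_e)
  qed
  have pos: "0 \<le> G d" if "\<And>n. 0 \<le> d n" for d :: "nat \<Rightarrow>\<^sub>C real"
    using that by (intro G_nonneg[of 1] J_mono) auto
  have "0 \<le> G (e - S e)" by (intro pos) (simp add: S_apply e_apply shiftR_def)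
  with superlinear_eigenfunctional[OF G S G_e G_S]
  obtain \<delta> q where \<delta>: "0 \<le> \<delta>" "\<delta> \<le> 1" and q: "linear q" "\<And>d. G d \<le> q d"
    and eig: "\<And>d. q (S d) = \<delta> * q d" by blast
  define p where "p y = (if y \<in> linf then q (Bcontfun y) else 0)" for y
  have Bc_add: "Bcontfun (\<lambda>n. y n + z n) = Bcontfun y + Bcontfun z" if "y \<in> linf" "z \<in> linf" for y z
    using that by (intro bcontfun_eqI) (simp add: apply_Bcontfun linf_add)
  have Bc_scale: "Bcontfun (\<lambda>n. a * y n) = a *\<^sub>R Bcontfun y" if "y \<in> linf" for a y
    using that by (intro bcontfun_eqI) (simp add: apply_Bcontfun linf_scale)
  have q_e: "q e = 1"
    using G_e[of 0 1] G_e[of 0 "-1"] q(2)[of e] q(2)[of "- e"] linear_neg[OF q(1), of e]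
      superlinear_zero[OF G] by simp
  have "p \<in> Delta"
    unfolding Delta_def mem_Collect_eq
  proof (intro conjI ballI allI impI)
    fix y z assume "y \<in> linf" "z \<in> linf"
    then show "p (\<lambda>n. y n + z n) = p y + p z"
      by (simp add: p_def linf_add Bc_add linear_add[OF q(1)])
  next
    fix y a assume "y \<in> linf"
    then show "p (\<lambda>n. a * y n) = a * p y"
      by (simp add: p_def linf_scale Bc_scale linear_scale[OF q(1)])
  next
    fix y assume "y \<in> linf" "\<forall>n. 0 \<le> y n"
    then have "0 \<le> G (Bcontfun y)" by (intro pos) (simp add: apply_Bcontfun)
    then show "0 \<le> p y" using q(2)[of "Bcontfun y"] \<open>y \<in> linf\<close> by (simp add: p_def)
  next
    have "Bcontfun (cseq 1) = e"
      by (intro bcontfun_eqI) (simp add: apply_Bcontfun linf_cseq e_apply, simp add: cseq_def)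
    then show "p (cseq 1) = 1" by (simp add: p_def linf_cseq q_e)
  qed (simp add: p_def)
  moreover have "p (shiftR y) = \<delta> * p y" if "y \<in> linf" for y
    using that eig[of "Bcontfun y"] by (simp add: p_def linf_shiftR S_def apply_Bcontfun)
  ultimately have "p \<in> DD" using \<delta> by (auto simp: DD_iff)
  then show thesis
  proof (rule that)
    fix y assume y: "y \<in> linf"
    \<comment> \<open>The step 1 in direction \<open>y - x\<close> leads from \<open>x\<close>
      exactly to \<open>y\<close>.\<close>
    have "J (Bcontfun y) - J u \<le> q (Bcontfun y - u)"
      using G_ge[of 1 "Bcontfun y - u"] q(2)[of "Bcontfun y - u"] by simp
    then show "I y - p y \<le> I x - p x"
      using x y by (simp add: J_def u_def p_def apply_Bcontfun linear_diff[OF q(1)])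
  qed
qed

section \<open>Axioms and shift niveloids\<close>

text \<open>Continuity and connectedness of [0,1] give a constant equivalent, and ICRP its
  translation invariance. Convexity speaks only of upper level sets; ICRP upgrades it to concavity
  by moving both sequences to value 0.\<close>

lemma axioms_imp_niveloid:
  assumes "weak_order R" "monotonicity R" "continuity R" "ICRP R" "convexity R" "IDIS R"
  obtains I where "shift_niveloid I" "constant_equivalent R I"
proof -
  have total: "R x y \<or> R y x" if "x \<in> linf" "y \<in> linf" for x y
    using assms(1)[unfolded weak_order_def, THEN conjunct1] that by blast
  have tr: "R x z" if "R x y" "R y z" "x \<in> linf" "y \<in> linf" "z \<in> linf" for x y z
    using assms(1)[unfolded weak_order_def, THEN conjunct2] that by blast
  have mono: "R x y" if "x \<in> linf" "y \<in> linf" "\<And>n. y n \<le> x n" for x y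
    using assms(2) that unfolding monotonicity_def by blast
  have icrp: "R (\<lambda>n. x n + r) (\<lambda>n. y n + r)" if "R x y" "x \<in> linf" "y \<in> linf" for x y r
    using assms(4) that unfolding ICRP_def by blast
  \<comment> \<open>If \<open>s < r\<close> and yet \<open>s\<close> is weakly preferred to
    \<open>r\<close>, iterated ICRP makes 0 weakly preferred to every multiple of
    \<open>r - s\<close>, hence to 1, against Monotonicity.\<close>
  have strict: "r \<le> s" if "R (cseq s) (cseq r)" for r s
  proof (rule ccontr)
    assume "\<not> r \<le> s"
    then have pos: "r - s > 0" by simp
    have "R (cseq 0) (cseq (real n * (r - s)))" for n
    proof (induction n)
      case 0 show ?case using mono linf_cseq by simp
    next
      case (Suc n)
      have "R (cseq (real n * (r - s))) (cseq (real (Suc n) * (r - s)))"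
        using icrp[OF that linf_cseq linf_cseq, of "real n * (r - s) - s"]
        by (simp add: cseq_def algebra_simps)
      then show ?case using Suc tr linf_cseq by blast
    qed
    moreover obtain n where "1 < real n * (r - s)" using pos reals_Archimedean3 by blast
    moreover from this have "R (cseq (real n * (r - s))) (cseq 1)"
      by (intro mono linf_cseq) (simp add: cseq_def)
    ultimately have "R (cseq 0) (cseq 1)" using tr linf_cseq by blast
    then show False using assms(2) by (simp add: monotonicity_def)
  qed
  have "\<exists>r. R x (cseq r) \<and> R (cseq r) x" if x: "x \<in> linf" for x
  proof -
    obtain B where B: "\<And>n. \<bar>x n\<bar> \<le> B" using x by (auto simp: linf_def)
    have "- B \<le> x n" "x n \<le> B" for n using B[of n] by linarith+
    then have top: "R (cseq B) x" and bot: "R x (cseq (- B))"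
      using mono[OF linf_cseq x] mono[OF x linf_cseq] by (simp_all add: cseq_def)
    \<comment> \<open>The constants run from \<open>- B\<close> at 0 to \<open>B\<close> at 1. The
      two closed preference sets cover [0,1] and both meet it, so they share a point, which is the
      constant equivalent.\<close>
    define T where "T = (\<lambda>\<alpha>. cseq (\<alpha> * B + (1 - \<alpha>) * (- B)))"
    have T: "T \<alpha> = (\<lambda>n. \<alpha> * cseq B n + (1 - \<alpha>) * cseq (- B) n)" for \<alpha> by (simp add: T_def cseq_def)
    have "closed {\<alpha>. \<alpha> \<in> {0..1} \<and> R (T \<alpha>) x}" "closed {\<alpha>. \<alpha> \<in> {0..1} \<and> R x (T \<alpha>)}"
      using assms(3) linf_cseq x top bot unfolding T continuity_def by blast+
    moreover have "connected {0..1::real}" by simp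
    moreover have "{0..1} \<subseteq> {\<alpha>. \<alpha> \<in> {0..1} \<and> R (T \<alpha>) x} \<union> {\<alpha>. \<alpha> \<in> {0..1} \<and> R x (T \<alpha>)}"
      using total x linf_cseq by (auto simp: T_def)
    moreover have "1 \<in> {\<alpha>. \<alpha> \<in> {0..1} \<and> R (T \<alpha>) x} \<inter> {0..1}"
      "0 \<in> {\<alpha>. \<alpha> \<in> {0..1} \<and> R x (T \<alpha>)} \<inter> {0..1}" using top bot by (auto simp: T_def)
    ultimately obtain \<alpha> where "R (T \<alpha>) x" "R x (T \<alpha>)" unfolding connected_closed by blast
    then show ?thesis unfolding T_def by blast
  qed
  then obtain I where I: "\<And>x. x \<in> linf \<Longrightarrow> R x (cseq (I x)) \<and> R (cseq (I x)) x" by metis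
  have rep: "R x y \<longleftrightarrow> I y \<le> I x" if xy: "x \<in> linf" "y \<in> linf" for x y
  proof
    assume "R x y"
    then have "R (cseq (I x)) (cseq (I y))" using I xy tr linf_cseq by meson
    then show "I y \<le> I x" by (rule strict)
  next
    assume "I y \<le> I x"
    then have "R (cseq (I x)) (cseq (I y))" by (intro mono linf_cseq) (simp add: cseq_def)
    then show "R x y" using I xy tr linf_cseq by meson
  qed
  have I_cseq: "I (cseq r) = r" for r using I[OF linf_cseq, of r] strict by (auto intro: antisym)
  have I_add: "I (\<lambda>n. x n + r) = I x + r" if x: "x \<in> linf" for x r
  proof -
    have "R (\<lambda>n. x n + r) (\<lambda>n. cseq (I x) n + r)" "R (\<lambda>n. cseq (I x) n + r) (\<lambda>n. x n + r)"
      using icrp I x linf_cseq by blast+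
    moreover have "(\<lambda>n. cseq (I x) n + r) = cseq (I x + r)" by (simp add: cseq_def)
    ultimately show ?thesis using rep[OF linf_add[OF x linf_const] linf_cseq] rep[OF linf_cseq linf_add[OF x linf_const]]
      by (simp add: I_cseq antisym)
  qed
  have "l * I x + (1 - l) * I y \<le> I (\<lambda>n. l * x n + (1 - l) * y n)"
    if xy: "x \<in> linf" "y \<in> linf" and l: "l \<in> {0..1}" for x y l
  proof -
    define x' y' where "x' = (\<lambda>n. x n + (- I x))" and "y' = (\<lambda>n. y n + (- I y))"
    have in': "x' \<in> linf" "y' \<in> linf" unfolding x'_def y'_def by (intro linf_add xy linf_const)+
    have "I x' = 0" "I y' = 0" unfolding x'_def y'_def by (simp_all only: I_add xy add.right_inverse)
    then have "R x' (cseq 0)" "R y' (cseq 0)" using rep in' linf_cseq I_cseq by simp_all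
    then have "R (\<lambda>n. l * x' n + (1 - l) * y' n) (cseq 0)"
      using assms(5) in' l unfolding convexity_def by blast
    then have "0 \<le> I (\<lambda>n. l * x' n + (1 - l) * y' n)"
      using rep in' linf_cseq linf_combination I_cseq by simp
    also have "(\<lambda>n. l * x' n + (1 - l) * y' n)
        = (\<lambda>n. (l * x n + (1 - l) * y n) + (- (l * I x + (1 - l) * I y)))"
      by (simp add: x'_def y'_def algebra_simps)
    also have "I \<dots> = I (\<lambda>n. l * x n + (1 - l) * y n) + (- (l * I x + (1 - l) * I y))"
      by (intro I_add linf_combination xy)
    finally show ?thesis by simp
  qed
  moreover have "I x \<le> I (\<lambda>n. x n + shiftR d n)"
    if "x \<in> linf" "d \<in> linf" "I x \<le> I (\<lambda>n. x n + d n)" for x d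
    using assms(6) that rep linf_add linf_shiftR unfolding IDIS_def by blast
  ultimately have "shift_niveloid I"
    unfolding shift_niveloid_def using I_cseq I_add rep mono by blast
  moreover have "constant_equivalent R I" unfolding constant_equivalent_def using I rep by blast
  ultimately show thesis by (rule that)
qed

lemma niveloid_imp_axioms:
  assumes I: "shift_niveloid I" and R: "constant_equivalent R I"
  shows "weak_order R" "monotonicity R" "continuity R" "ICRP R" "convexity R" "IDIS R"
proof -
  have rep: "R x y \<longleftrightarrow> I y \<le> I x" if "x \<in> linf" "y \<in> linf" for x y
    using R that unfolding constant_equivalent_def by blast
  show "weak_order R" unfolding weak_order_def using rep by (auto intro: order_trans)
  show "monotonicity R"
    unfolding monotonicity_def using niveloid_mono[OF I] rep by (auto simp: linf_cseq niveloid_cseq[OF I])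
  show "continuity R"
    unfolding continuity_def
  proof (intro ballI impI)
    fix x y z assume xyz: "x \<in> linf" "y \<in> linf" "z \<in> linf"
    \<comment> \<open>The niveloid is 1-Lipschitz in the sup norm, so \<open>g\<close> is Lipschitz
      with any bound \<open>B\<close> on the coordinates of \<open>x - z\<close>; this yields
      Continuity.\<close>
    define g where "g \<alpha> = I (\<lambda>n. \<alpha> * x n + (1 - \<alpha>) * z n)" for \<alpha>
    obtain B where B: "\<And>n. \<bar>1 * x n + (-1) * z n\<bar> \<le> B"
      using linf_combination[OF xyz(1,3), of 1 "-1"] unfolding linf_def by blast
    have "B-lipschitz_on UNIV g"
    proof (rule lipschitz_onI)
      fix \<alpha> \<beta> :: real
      show "dist (g \<alpha>) (g \<beta>) \<le> B * dist \<alpha> \<beta>"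
        unfolding g_def dist_real_def
      proof (rule niveloid_lipschitz[OF I linf_combination[OF xyz(1,3)] linf_combination[OF xyz(1,3)]])
        fix n
        have "\<alpha> * x n + (1 - \<alpha>) * z n - (\<beta> * x n + (1 - \<beta>) * z n) = (1 * x n + (-1) * z n) * (\<alpha> - \<beta>)"
          by (simp add: algebra_simps)
        then show "\<bar>\<alpha> * x n + (1 - \<alpha>) * z n - (\<beta> * x n + (1 - \<beta>) * z n)\<bar> \<le> B * \<bar>\<alpha> - \<beta>\<bar>"
          using B[of n] by (simp only: abs_mult mult_right_mono abs_ge_zero)
      qed
    next
      show "0 \<le> B" using B[of 0] by linarith
    qed
    then have g: "continuous_on UNIV g" by (rule lipschitz_on_continuous_on)
    have *: "closed {\<alpha>. \<alpha> \<in> {0..1} \<and> I y \<le> g \<alpha>}" "closed {\<alpha>. \<alpha> \<in> {0..1} \<and> g \<alpha> \<le> I y}"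
      unfolding Collect_conj_eq Collect_mem_eq
      by (intro closed_Int closed_atLeastAtMost closed_Collect_le continuous_on_const g)+
    show "closed {\<alpha>. \<alpha> \<in> {0..1} \<and> R (\<lambda>n. \<alpha> * x n + (1 - \<alpha>) * z n) y} \<and>
          closed {\<alpha>. \<alpha> \<in> {0..1} \<and> R y (\<lambda>n. \<alpha> * x n + (1 - \<alpha>) * z n)}"
      using * by (simp add: rep linf_combination xyz g_def)
  qed
  show "ICRP R"
    unfolding ICRP_def using rep by (auto simp: linf_add linf_const niveloid_translate[OF I])
  show "convexity R"
    unfolding convexity_def
  proof (intro ballI allI impI)
    fix x y \<theta> l assume xy: "x \<in> linf" "y \<in> linf" and "R x (cseq \<theta>)" "R y (cseq \<theta>)" and l: "l \<in> {0..1::real}"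
    then have "\<theta> \<le> I x" "\<theta> \<le> I y" by (auto simp: rep linf_cseq niveloid_cseq[OF I])
    then have "l * \<theta> + (1 - l) * \<theta> \<le> l * I x + (1 - l) * I y"
      using l by (intro add_mono mult_left_mono) auto
    also have "\<dots> \<le> I (\<lambda>n. l * x n + (1 - l) * y n)" using l by (intro niveloid_concave[OF I] xy) auto
    also have "l * \<theta> + (1 - l) * \<theta> = \<theta>" by (simp add: algebra_simps)
    finally show "R (\<lambda>n. l * x n + (1 - l) * y n) (cseq \<theta>)"
      by (simp add: rep linf_cseq linf_combination xy niveloid_cseq[OF I])
  qed
  show "IDIS R"
    unfolding IDIS_def using rep niveloid_shiftR[OF I] by (auto simp: linf_add linf_shiftR)
qed

section \<open>Functionals given by the variational formula\<close>

text \<open>Each clause holds for every \<open>q x + c q\<close> and passes to the infimum. The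
  hypotheses \<open>lower\<close> and \<open>greatest\<close> express that infimum with real costs
  on a subset \<open>D\<close> of \<open>DD\<close>, which avoids extended arithmetic.\<close>

lemma variational_imp_niveloid:
  assumes D: "D \<subseteq> DD" and zero: "I (cseq 0) = 0"
    and lower: "\<And>x q. x \<in> linf \<Longrightarrow> q \<in> D \<Longrightarrow> I x \<le> q x + c q"
    and greatest: "\<And>x b. x \<in> linf \<Longrightarrow> (\<And>q. q \<in> D \<Longrightarrow> b \<le> q x + c q) \<Longrightarrow> b \<le> I x"
  shows "shift_niveloid I"
proof -
  have Delta: "q \<in> Delta" if "q \<in> D" for q using D that by (auto simp: DD_iff)
  have "I y \<le> I x" if "x \<in> linf" "y \<in> linf" "\<And>n. y n \<le> x n" for x y
  proof (rule greatest[OF that(1)])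
    fix q assume q: "q \<in> D"
    show "I y \<le> q x + c q" using lower[OF that(2) q] Delta_mono[OF Delta[OF q] that] by simp
  qed
  moreover have "I (\<lambda>n. x n + r) = I x + r" if x: "x \<in> linf" for x r
  proof -
    have ge: "I x + r \<le> I (\<lambda>n. x n + r)" if x: "x \<in> linf" for x r
    proof (rule greatest[OF linf_add[OF x linf_const]])
      fix q assume q: "q \<in> D"
      show "I x + r \<le> q (\<lambda>n. x n + r) + c q"
        using lower[OF x q] by (simp add: Delta_add_const[OF Delta[OF q] x])
    qed
    show ?thesis using ge[OF x, of r] ge[OF linf_add[OF x linf_const], of r "- r"] by simp
  qed
  moreover have "l * I x + (1 - l) * I y \<le> I (\<lambda>n. l * x n + (1 - l) * y n)"
    if xy: "x \<in> linf" "y \<in> linf" and l: "l \<in> {0..1}" for x y l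
  proof (rule greatest[OF linf_combination[OF xy]])
    fix q assume q: "q \<in> D"
    have "l * I x + (1 - l) * I y \<le> l * (q x + c q) + (1 - l) * (q y + c q)"
      using l lower xy q by (intro add_mono mult_left_mono) auto
    also have "\<dots> = q (\<lambda>n. l * x n + (1 - l) * y n) + c q"
      unfolding Delta_combination[OF Delta[OF q] xy] by (simp add: algebra_simps)
    finally show "l * I x + (1 - l) * I y \<le> q (\<lambda>n. l * x n + (1 - l) * y n) + c q" .
  qed
  moreover have "I x \<le> I (\<lambda>n. x n + shiftR d n)"
    if xd: "x \<in> linf" "d \<in> linf" and le: "I x \<le> I (\<lambda>n. x n + d n)" for x d
  proof (rule greatest[OF linf_add[OF xd(1) linf_shiftR[OF xd(2)]]])
    fix q assume q: "q \<in> D"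
    then have "q \<in> DD" using D by blast
    then obtain \<delta> where \<delta>: "\<delta> \<in> {0..1}" "q (shiftR d) = \<delta> * q d" using xd(2) unfolding DD_iff by blast
    have eq: "q (\<lambda>n. x n + shiftR d n) = q x + \<delta> * q d"
      using \<delta>(2) Delta_add[OF Delta[OF q] xd(1) linf_shiftR[OF xd(2)]] by simp
    \<comment> \<open>If \<open>q d \<ge> 0\<close>, compare with the value at \<open>x\<close>;
      otherwise \<open>\<delta> * q d \<ge> q d\<close>, and the value at \<open>x + d\<close> is
      the one to compare with.\<close>
    show "I x \<le> q (\<lambda>n. x n + shiftR d n) + c q"
    proof (cases "0 \<le> q d")
      case True
      then have "0 \<le> \<delta> * q d" using \<delta>(1) by simp
      then show ?thesis using lower[OF xd(1) q] by (simp add: eq)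
    next
      case False
      then have "q d \<le> \<delta> * q d" using \<delta>(1) mult_right_mono_neg[of \<delta> 1 "q d"] by simp
      then show ?thesis
        using lower[OF linf_add[OF xd] q] le Delta_add[OF Delta[OF q] xd] by (simp add: eq)
    qed
  qed
  ultimately show ?thesis unfolding shift_niveloid_def using zero by blast
qed

section \<open>The variational representation of the preference\<close>

theorem theorem5:
  fixes R :: "seq \<Rightarrow> seq \<Rightarrow> bool"
  shows "(weak_order R \<and> monotonicity R \<and> continuity R \<and> ICRP R \<and> convexity R \<and> IDIS R)
     \<longleftrightarrow>
     (\<exists>c :: functional \<Rightarrow> ereal.
        (\<forall>p\<in>DD. c p \<ge> 0) \<and>
        (INF p\<in>DD. c p) = 0 \<and>
        weak_star_lsc_on DD c \<and>
        (\<forall>x\<in>linf. \<exists>p\<in>DD. \<forall>q\<in>DD. ereal (p x) + c p \<le> ereal (q x) + c q) \<and>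
        constant_equivalent R
          (\<lambda>x. real_of_ereal (INF p\<in>DD. ereal (p x) + c p)))"
    (is "?axioms \<longleftrightarrow> (\<exists>c. ?representation c)")
proof
  assume ?axioms
  then obtain I where I: "shift_niveloid I" and R: "constant_equivalent R I"
    using axioms_imp_niveloid by blast
  \<comment> \<open>The concave conjugate of \<open>I\<close>: the smallest cost with
    \<open>I x \<le> p x + c p\<close> for all \<open>x\<close> in \<open>linf\<close>.\<close>
  define c where "c p = (SUP x\<in>linf. ereal (I x - p x))" for p
  have upper: "ereal (I x - p x) \<le> c p" if "x \<in> linf" for x p
    unfolding c_def using that by (rule SUP_upper)
  have lower: "ereal (I x) \<le> ereal (q x) + c q" if "x \<in> linf" for x q
    using upper[OF that, of q] by (cases "c q") simp_all
  \<comment> \<open>At a supergradient \<open>p\<close> of \<open>I\<close> at \<open>x\<close>, the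
    supremum defining \<open>c p\<close> is attained at \<open>x\<close> itself.\<close>
  have attained: "\<exists>p\<in>DD. ereal (p x) + c p = ereal (I x)" if x: "x \<in> linf" for x
  proof -
    obtain p where p: "p \<in> DD" "\<And>y. y \<in> linf \<Longrightarrow> I y - p y \<le> I x - p x"
      using niveloid_supergradient[OF I x] by blast
    have "c p \<le> ereal (I x - p x)" unfolding c_def using p(2) by (intro SUP_least) simp
    then have "c p = ereal (I x - p x)" using upper[OF x] by (rule antisym)
    then show ?thesis using p(1) by (intro bexI[of _ p]) simp_all
  qed
  have INF_eq: "(INF p\<in>DD. ereal (p x) + c p) = ereal (I x)" if x: "x \<in> linf" for x
  proof (rule antisym)
    obtain p where p: "p \<in> DD" "ereal (p x) + c p = ereal (I x)" using attained[OF x] by blast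
    show "(INF p\<in>DD. ereal (p x) + c p) \<le> ereal (I x)"
      unfolding p(2)[symmetric] using p(1) by (rule INF_lower)
    show "ereal (I x) \<le> (INF p\<in>DD. ereal (p x) + c p)"
      by (intro INF_greatest lower x)
  qed
  have "0 \<le> c p" if "p \<in> DD" for p
    using upper[OF linf_cseq, of 0 p] DD_zero[OF that] by (simp add: niveloid_cseq[OF I] zero_ereal_def)
  moreover have "(INF p\<in>DD. c p) = 0"
  proof -
    have "(INF p\<in>DD. c p) = ereal (I (cseq 0))"
      using INF_eq[OF linf_cseq, of 0] by (simp only: INF_at_zero)
    then show ?thesis by (simp add: niveloid_cseq[OF I] zero_ereal_def)
  qed
  moreover have "weak_star_lsc_on DD c"
    unfolding weak_star_lsc_on_def
  proof (intro ballI allI impI)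
    fix p t assume "t < c p"
    then obtain x where x: "x \<in> linf" and "t < ereal (I x - p x)"
      unfolding c_def less_SUP_iff by blast
    \<comment> \<open>As a supremum of the weak-star continuous maps
      \<open>p \<mapsto> I x - p x\<close>, \<open>c\<close> is lower semicontinuous. One
      \<open>x\<close> determines the neighbourhood, and \<open>s\<close> strictly above
      \<open>t\<close> leaves its radius \<open>I x - p x - s\<close>.\<close>
    then obtain s where s: "t < ereal s" "s < I x - p x"
      using ereal_dense2[of t "ereal (I x - p x)"] by auto
    have "t < c q" if "\<bar>q x - p x\<bar> < I x - p x - s" for q
    proof -
      have "ereal s \<le> ereal (I x - q x)" using that by simp
      then show ?thesis using s(1) upper[OF x, of q] by (meson less_le_trans order_trans)
    qed
    then show "\<exists>F \<eta>. finite F \<and> F \<subseteq> linf \<and> \<eta> > 0 \<and>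
        (\<forall>q\<in>DD. (\<forall>x\<in>F. \<bar>q x - p x\<bar> < \<eta>) \<longrightarrow> t < c q)"
      using x s(2) by (intro exI[of _ "{x}"] exI[of _ "I x - p x - s"]) simp
  qed
  moreover have "\<exists>p\<in>DD. \<forall>q\<in>DD. ereal (p x) + c p \<le> ereal (q x) + c q" if x: "x \<in> linf" for x
  proof -
    obtain p where "p \<in> DD" "ereal (p x) + c p = ereal (I x)" using attained[OF x] by blast
    then show ?thesis using lower[OF x] by (intro bexI[of _ p]) simp_all
  qed
  moreover have "constant_equivalent R (\<lambda>x. real_of_ereal (INF p\<in>DD. ereal (p x) + c p))"
    using R by (simp add: constant_equivalent_def INF_eq)
  ultimately have "?representation c" by (intro conjI ballI)
  then show "\<exists>c. ?representation c" by (rule exI[of _ c])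
next
  assume "\<exists>c. ?representation c"
  then obtain c where nonneg: "\<And>p. p \<in> DD \<Longrightarrow> 0 \<le> c p" and grounded: "(INF p\<in>DD. c p) = 0"
    and R: "constant_equivalent R (\<lambda>x. real_of_ereal (INF p\<in>DD. ereal (p x) + c p))" by (elim exE conjE) blast
  define I where "I x = real_of_ereal (INF p\<in>DD. ereal (p x) + c p)" for x
  \<comment> \<open>The effective domain of \<open>c\<close>: costs are real on it, and groundedness
    makes it nonempty.\<close>
  define D where "D = {q \<in> DD. c q \<noteq> \<infinity>}"
  have finite_c: "c q = ereal (real_of_ereal (c q))" if "q \<in> D" for q
    using nonneg[of q] that by (cases "c q") (auto simp: D_def)
  obtain p where "p \<in> DD" "c p < 1" using grounded INF_less_iff[of c DD 1] by auto
  then have p: "p \<in> D" by (auto simp: D_def)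
  \<comment> \<open>The infimum has to be finite, since \<open>real_of_ereal\<close> would send
    infinite values to 0. It is at least \<open>- B\<close> because costs are nonnegative, and below
    infinity because of the \<open>p\<close> of finite cost.\<close>
  have I: "ereal (I x) = (INF p\<in>DD. ereal (p x) + c p)" if x: "x \<in> linf" for x
  proof -
    obtain B where B: "\<And>n. \<bar>x n\<bar> \<le> B" using x by (auto simp: linf_def)
    have "ereal (- B) \<le> ereal (q x) + c q" if "q \<in> DD" for q
    proof -
      have "q \<in> Delta" using that by (simp add: DD_iff)
      from Delta_abs_le[OF this x B] have "- B \<le> q x" by simp
      then have "ereal (- B) + 0 \<le> ereal (q x) + c q" using nonneg[OF that] by (intro add_mono) simp_all
      then show ?thesis by simp
    qed
    then have "ereal (- B) \<le> (INF p\<in>DD. ereal (p x) + c p)" by (rule INF_greatest)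
    moreover have "(INF p\<in>DD. ereal (p x) + c p) \<le> ereal (p x) + c p"
      using p by (intro INF_lower) (simp add: D_def)
    moreover have "ereal (p x) + c p \<noteq> \<infinity>" using p by (simp add: D_def)
    ultimately show ?thesis unfolding I_def by (intro ereal_real') auto
  qed
  have "shift_niveloid I"
  proof (rule variational_imp_niveloid[where D = D and c = "\<lambda>q. real_of_ereal (c q)"])
    show "D \<subseteq> DD" by (auto simp: D_def)
    show "I (cseq 0) = 0" unfolding I_def INF_at_zero grounded by simp
  next
    fix x q assume x: "x \<in> linf" and q: "q \<in> D"
    have "ereal (I x) \<le> ereal (q x) + c q"
      unfolding I[OF x] using q by (intro INF_lower) (simp add: D_def)
    then show "I x \<le> q x + real_of_ereal (c q)" using finite_c[OF q] by (metis ereal_less_eq(3) plus_ereal.simps(1))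
  next
    fix x b assume x: "x \<in> linf" and b: "\<And>q. q \<in> D \<Longrightarrow> b \<le> q x + real_of_ereal (c q)"
    have "ereal b \<le> ereal (q x) + c q" if "q \<in> DD" for q
    proof (cases "c q = \<infinity>")
      case False
      then have q: "q \<in> D" using that by (simp add: D_def)
      show ?thesis using b[OF q] finite_c[OF q] by (metis ereal_less_eq(3) plus_ereal.simps(1))
    qed simp
    then have "ereal b \<le> ereal (I x)" unfolding I[OF x] by (rule INF_greatest)
    then show "b \<le> I x" by simp
  qed
  then show ?axioms using niveloid_imp_axioms[of I R] R unfolding I_def by blast
qed

end
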